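(* Consider the Riemann problem of the multi-commodity kinematic wave model of diverging traffic with one upstream link $0$ and two downstream links $1,2$, with predefined constant commodity proportions $\xi_1,\xi_2>0$, $\xi_1+\xi_2=1$, and initial states $U_0=(D_0,S_0)$ on link $0$ and $U_i=(D_i,S_i)$ on link $i$ ($i=1,2$). The boundary fluxes satisfying the entropy condition $$q_0=\min\left\{D_0(0^-,t),\ \frac{S_1(0^+,t)}{\xi_1(0^-,t)},\ \frac{S_2(0^+,t)}{\xi_2(0^-,t)}\right\}$$ (with the local First-In-First-Out principle $q_i=\xi_i(0^-,t)q_0$, $i=1,2$), the traffic conservation equations (including the global First-In-First-Out principle $q_i=\xi_i q_0$), and the admissible conditions on stationary and interior states are $$q_0=\min\left\{D_0,\ \frac{S_1}{\xi_1},\ \frac{S_2}{\xi_2}\right\},\qquad q_i=\xi_i q_0\quad (i=1,2).$$ The corresponding stationary and interior states are as follows. 1. If $D_0>q_0$, the stationary state of the upstream link is SOC, and $U_0(0^-,t)=U_0^-=(C_0,q_0)$. If $D_0=q_0$, the stationary state of the upstream link is UC, $U_0^-=(D_0,C_0)$, and either $U_0(0^-,t)=U_0^-$ or $U_0(0^-,t)=(D_0(0^-,t),S_0(0^-,t))$ with $D_0(0^-,t)>D_0$ and $S_0(0^-,t)\ge D_0$. 2. For $i=1,2$: if $\frac{S_i}{\xi_i}>q_0$, the stationary state of downstream link $i$ is SUC, and $U_i(0^+,t)=U_i^+=(q_i,C_i)$. If $\frac{S_i}{\xi_i}=q_0$, the stationary state of downstream link $i$ is OC, $U_i^+=(C_i,S_i)$,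 and either $U_i(0^+,t)=U_i^+$ or $U_i(0^+,t)=(D_i(0^+,t),S_i(0^+,t))$ with $D_i(0^+,t)\ge S_i$ and $S_i(0^+,t)>S_i$.
   Context: Network and model. A diverge has one upstream link $0$ (coordinate $x_0\in(-\infty,0)$) and two downstream links $1,2$ (coordinates $x_i\in(0,\infty)$), meeting at $x=0$; commodity $p\in\{1,2\}$ consists of the vehicles travelling from link $0$ to link $p$. Each link $a$ is homogeneous with a unimodal flow-density relation $q=Q_a(\rho)=\rho V_a(\rho)$, critical density $\rho_{c,a}$, and capacity $C_a=Q_a(\rho_{c,a})>0$. The multi-commodity kinematic wave (MCKW) model is $\partial_t\rho_p+\partial_x(\rho_p V_a(\rho_a))=0$ for each commodity $p$ along its path, where $\rho_a$ is the total density on link $a$. The Riemann problem has constant initial density on each link. Supply-demand space. Demand and supply on link $a$ are $D(\rho)=Q_a(\min\{\rho,\rho_{c,a}\})$ and $S(\rho)=Q_a(\max\{\rho,\rho_{c,a}\})$. A traffic state on link $a$ is represented as a pair $U=(D,S)$ with $0\le D,S\le C_a$ and $\max\{D,S\}=C_a$; its flow-rate is $q(U)=\min\{D,S\}$. A state is under-critical (UC) if $S=C_a$, over-critical (OC) if $D=C_a$, strictly under-critical (SUC) if $D<S=C_a$, strictly over-critical (SOC) if $S<D=C_a$. The initial states are $U_0=(D_0,S_0)$ and $U_i=(D_i,S_i)$. Unknowns (for $t>0$): stationary states $U_0^-=(D_0^-,S_0^-)$ on link $0$ and $U_i^+=(D_i^+,S_i^+)$ on link $i$; interior states at the junction $U_0(0^-,t)=(D_0(0^-,t),S_0(0^-,t))$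 (a state on link $0$) and $U_i(0^+,t)=(D_i(0^+,t),S_i(0^+,t))$ (a state on link $i$), $i=1,2$; and interior commodity proportions $\xi_i(0^-,t)$. Boundary fluxes and traffic conservation: $q_0=q(U_0^-)$, $q_i=q(U_i^+)$, $q_0=q_1+q_2$. Global First-In-First-Out principle: $q_i=\xi_i q_0$, $i=1,2$. Comparing the local and global First-In-First-Out principles, the interior proportions in this model are taken to be $\xi_i(0^-,t)=\xi_i$. Admissible conditions for stationary states: $U_0^-=(D_0,C_0)$, or $U_0^-=(C_0,S_0^-)$ with $S_0^-<D_0$; and $U_i^+=(C_i,S_i)$, or $U_i^+=(D_i^+,C_i)$ with $D_i^+<S_i$. Admissible conditions for interior states: if $U_0^-$ is SOC then $U_0(0^-,t)=U_0^-$; if $U_0^-$ is UC then $U_0(0^-,t)$ is any state on link $0$ with $S_0(0^-,t)\ge D_0^-$; if $U_i^+$ is SUC then $U_i(0^+,t)=U_i^+$; if $U_i^+$ is OC then $U_i(0^+,t)$ is any state on link $i$ with $D_i(0^+,t)\ge S_i^+$. *)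

theory Defs imports Complex_Main begin

record link =
  speed :: "real \<Rightarrow> real"
  critical_density :: real

definition flow :: "link \<Rightarrow> real \<Rightarrow> real" where
  "flow a \<rho> = \<rho> * speed a \<rho>"

definition capacity :: "link \<Rightarrow> real" where
  "capacity a = flow a (critical_density a)"

text \<open>The speed is a total function; beyond a jam density, if there is one, it is to be continued
  by 0. Monotonicity is not required to be strict, so that this is possible.\<close>

definition unimodal_link :: "link \<Rightarrow> bool" where
  "unimodal_link a \<longleftrightarrow>
     0 \<le> critical_density a \<and> (\<forall>\<rho>\<ge>0. 0 \<le> speed a \<rho>) \<and>
     mono_on {0..critical_density a} (flow a) \<and>
     antimono_on {critical_density a..} (flow a) \<and>
     0 < capacity a"

definition demand_at :: "link \<Rightarrow> real \<Rightarrow> real" where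
  "demand_at a \<rho> = flow a (min \<rho> (critical_density a))"

definition supply_at :: "link \<Rightarrow> real \<Rightarrow> real" where
  "supply_at a \<rho> = flow a (max \<rho> (critical_density a))"

text \<open>Traffic states live in the supply-demand space: a state is the pair \<open>(D, S)\<close>.\<close>

type_synonym state = "real \<times> real"

abbreviation Dem :: "state \<Rightarrow> real" where "Dem \<equiv> fst"
abbreviation Sply :: "state \<Rightarrow> real" where "Sply \<equiv> snd"

definition state_on :: "link \<Rightarrow> state \<Rightarrow> bool" where
  "state_on a U \<longleftrightarrow>
     0 \<le> Dem U \<and> Dem U \<le> capacity a \<and> 0 \<le> Sply U \<and> Sply U \<le> capacity a \<and>
     max (Dem U) (Sply U) = capacity a"

lemma state_on_density:
  assumes "unimodal_link a" "0 \<le> \<rho>"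
  shows "state_on a (demand_at a \<rho>, supply_at a \<rho>)"
proof -
  let ?c = "critical_density a"
  have c: "0 \<le> ?c" and v: "\<And>x. 0 \<le> x \<Longrightarrow> 0 \<le> flow a x"
    using assms(1) by (auto simp: unimodal_link_def flow_def)
  have "flow a \<rho> \<le> flow a ?c"
  proof (cases "\<rho> \<le> ?c")
    case True
    then show ?thesis
      using assms c by (auto simp: unimodal_link_def intro: mono_onD)
  next
    case False
    then show ?thesis
      using assms by (auto simp: unimodal_link_def monotone_on_def)
  qed
  then show ?thesis
    using c v[OF assms(2)] v[OF c]
    by (auto simp: state_on_def demand_at_def supply_at_def capacity_def min_def max_def)
qed

definition flow_rate :: "state \<Rightarrow> real" where
  "flow_rate U = min (Dem U) (Sply U)"

definition UC :: "link \<Rightarrow> state \<Rightarrow> bool" where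
  "UC a U \<longleftrightarrow> Sply U = capacity a"

definition OC :: "link \<Rightarrow> state \<Rightarrow> bool" where
  "OC a U \<longleftrightarrow> Dem U = capacity a"

definition SUC :: "link \<Rightarrow> state \<Rightarrow> bool" where
  "SUC a U \<longleftrightarrow> Dem U < Sply U \<and> Sply U = capacity a"

definition SOC :: "link \<Rightarrow> state \<Rightarrow> bool" where
  "SOC a U \<longleftrightarrow> Sply U < Dem U \<and> Dem U = capacity a"

text \<open>The unknowns of the Riemann problem. Links are indexed by 0 (upstream) and 1, 2 (downstream).
  \<open>stationary\<close> is \<open>U\<^sub>0\<^sup>-\<close> at index 0 and \<open>U\<^sub>i\<^sup>+\<close> at index \<open>i\<close>; \<open>interior 0 t\<close> is \<open>U\<^sub>0(0\<^sup>-,t)\<close> and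
  \<open>interior i t\<close> is \<open>U\<^sub>i(0\<^sup>+,t)\<close>; \<open>int_prop i t\<close> is \<open>\<xi>\<^sub>i(0\<^sup>-,t)\<close>. Only the values at these indices and
  at times \<open>t > 0\<close> are meaningful.\<close>

record unknowns =
  flux :: "nat \<Rightarrow> real"
  stationary :: "nat \<Rightarrow> state"
  interior :: "nat \<Rightarrow> real \<Rightarrow> state"
  int_prop :: "nat \<Rightarrow> real \<Rightarrow> real"

definition states_valid :: "(nat \<Rightarrow> link) \<Rightarrow> unknowns \<Rightarrow> bool" where
  "states_valid L z \<longleftrightarrow>
     (\<forall>a\<in>{0,1,2}. state_on (L a) (stationary z a) \<and> (\<forall>t>0. state_on (L a) (interior z a t)))"

definition traffic_conservation :: "(nat \<Rightarrow> real) \<Rightarrow> unknowns \<Rightarrow> bool" where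
  "traffic_conservation \<xi> z \<longleftrightarrow>
     (\<forall>a\<in>{0,1,2}. flux z a = flow_rate (stationary z a)) \<and>
     flux z 0 = flux z 1 + flux z 2 \<and>
     (\<forall>i\<in>{1,2}. flux z i = \<xi> i * flux z 0)"

definition interior_proportions :: "(nat \<Rightarrow> real) \<Rightarrow> unknowns \<Rightarrow> bool" where
  "interior_proportions \<xi> z \<longleftrightarrow> (\<forall>t>0. \<forall>i\<in>{1,2}. int_prop z i t = \<xi> i)"

text \<open>The last conjunct is the local First-In-First-Out principle; the global one, with the predefined
  proportions, is the last conjunct of \<open>traffic_conservation\<close>.\<close>

definition entropy_condition :: "unknowns \<Rightarrow> bool" where
  "entropy_condition z \<longleftrightarrow>
     (\<forall>t>0. flux z 0 = Min {Dem (interior z 0 t),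
                            Sply (interior z 1 t) / int_prop z 1 t,
                            Sply (interior z 2 t) / int_prop z 2 t} \<and>
            (\<forall>i\<in>{1,2}. flux z i = int_prop z i t * flux z 0))"

definition admissible_stationary :: "(nat \<Rightarrow> link) \<Rightarrow> (nat \<Rightarrow> state) \<Rightarrow> unknowns \<Rightarrow> bool" where
  "admissible_stationary L U z \<longleftrightarrow>
     (stationary z 0 = (Dem (U 0), capacity (L 0)) \<or>
      (\<exists>S. stationary z 0 = (capacity (L 0), S) \<and> S < Dem (U 0))) \<and>
     (\<forall>i\<in>{1,2}. stationary z i = (capacity (L i), Sply (U i)) \<or>
        (\<exists>D. stationary z i = (D, capacity (L i)) \<and> D < Sply (U i)))"

definition admissible_interior :: "(nat \<Rightarrow> link) \<Rightarrow> unknowns \<Rightarrow> bool" where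
  "admissible_interior L z \<longleftrightarrow> (\<forall>t>0.
     (SOC (L 0) (stationary z 0) \<longrightarrow> interior z 0 t = stationary z 0) \<and>
     (UC (L 0) (stationary z 0) \<longrightarrow> Sply (interior z 0 t) \<ge> Dem (stationary z 0)) \<and>
     (\<forall>i\<in>{1,2}.
        (SUC (L i) (stationary z i) \<longrightarrow> interior z i t = stationary z i) \<and>
        (OC (L i) (stationary z i) \<longrightarrow> Dem (interior z i t) \<ge> Sply (stationary z i))))"

definition diverge_solution ::
    "(nat \<Rightarrow> link) \<Rightarrow> (nat \<Rightarrow> real) \<Rightarrow> (nat \<Rightarrow> state) \<Rightarrow> unknowns \<Rightarrow> bool" where
  "diverge_solution L \<xi> U z \<longleftrightarrow>
     states_valid L z \<and> traffic_conservation \<xi> z \<and> interior_proportions \<xi> z \<and>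
     entropy_condition z \<and> admissible_stationary L U z \<and> admissible_interior L z"

end

theory Submission imports Defs begin

text \<open>
  On each link the admissible stationary states form a one-parameter family indexed by the flux that
  they carry: upstream the flux is at most \<open>D\<^sub>0\<close>, and the state is UC if the flux equals \<open>D\<^sub>0\<close> and
  SOC if it is smaller (\<open>admissible_upstream\<close>); downstream the same holds with demand and supply
  exchanged, the bound being \<open>S\<^sub>i\<close> (\<open>admissible_downstream\<close>). By FIFO, \<open>q\<^sub>i = \<xi>\<^sub>i q\<^sub>0\<close>, so \<open>q\<^sub>0\<close> is at most
  each of \<open>D\<^sub>0\<close>, \<open>S\<^sub>1 / \<xi>\<^sub>1\<close>, \<open>S\<^sub>2 / \<xi>\<^sub>2\<close>.

  It equals one of them. Otherwise the upstream state is SOC and both downstream states are SUC,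
  so all interior states coincide with the stationary ones, and the entropy condition reads
  \<open>q\<^sub>0 = min {C\<^sub>0, C\<^sub>1 / \<xi>\<^sub>1, C\<^sub>2 / \<xi>\<^sub>2}\<close>. But capacities bound demands and supplies from above, so this
  minimum exceeds \<open>q\<^sub>0\<close> (\<open>flux_determined\<close>). Once \<open>q\<^sub>0\<close> is known, so are the stationary states.
  On a link whose bound is attained, the entropy condition gives \<open>D\<^sub>0(0\<^sup>-,t) \<ge> D\<^sub>0\<close> or
  \<open>S\<^sub>i(0\<^sup>+,t) \<ge> S\<^sub>i\<close>, admissibility bounds the other coordinate of the interior state below by the
  same number, and equality in the first bound forces the interior state to be the stationary one
  (\<open>interior_alternatives\<close>).

  Conversely, the family members that carry the fluxes \<open>q\<^sub>0, \<xi>\<^sub>1 q\<^sub>0, \<xi>\<^sub>2 q\<^sub>0\<close>, used also as interior states,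
  solve the problem: raising a non-binding term of the minimum from demand or supply to capacity
  does not change the minimum (\<open>solution_exists\<close>).
\<close>

section \<open>Exchanging demand and supply\<close>

text \<open>Reflecting the supply-demand space turns a statement about states upstream of the junction
  into one about states downstream of it.\<close>

lemma state_on_swap [simp]: "state_on a (prod.swap V) \<longleftrightarrow> state_on a V"
  by (auto simp: state_on_def max.commute)

lemma flow_rate_swap [simp]: "flow_rate (prod.swap V) = flow_rate V"
  by (simp add: flow_rate_def min.commute)

section \<open>Stationary and interior states on a single link\<close>

definition upstream_state :: "link \<Rightarrow> state \<Rightarrow> real \<Rightarrow> state" where
  "upstream_state a U q = (if q < Dem U then (capacity a, q) else (Dem U, capacity a))"

definition downstream_state :: "link \<Rightarrow> state \<Rightarrow> real \<Rightarrow> state" where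
  "downstream_state a U q = prod.swap (upstream_state a (prod.swap U) q)"

text \<open>Both branches of the admissibility condition have an explicit flux, namely \<open>D\<^sub>0\<close> and \<open>S\<^sub>0\<^sup>-\<close>;
  the strict inequality \<open>S\<^sub>0\<^sup>- < D\<^sub>0\<close> keeps the branches apart, so the flux alone identifies the
  state.\<close>

lemma admissible_upstream:
  assumes "state_on a U"
    and "V = (Dem U, capacity a) \<or> (\<exists>S. V = (capacity a, S) \<and> S < Dem U)"
  shows "flow_rate V \<le> Dem U" "V = upstream_state a U (flow_rate V)"
  using assms by (auto simp: state_on_def flow_rate_def upstream_state_def)

lemma admissible_downstream:
  assumes "state_on a U"
    and "V = (capacity a, Sply U) \<or> (\<exists>D. V = (D, capacity a) \<and> D < Sply U)"
  shows "flow_rate V \<le> Sply U" "V = downstream_state a U (flow_rate V)"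
proof -
  note swapped = admissible_upstream[of a "prod.swap U" "prod.swap V"]
  have V': "prod.swap V = (Sply U, capacity a) \<or>
      (\<exists>D. prod.swap V = (capacity a, D) \<and> D < Sply U)"
    using assms(2) by auto
  show "flow_rate V \<le> Sply U"
    using swapped(1) V' assms(1) by simp
  have "prod.swap V = upstream_state a (prod.swap U) (flow_rate V)"
    using swapped(2) V' assms(1) by simp
  then show "V = downstream_state a U (flow_rate V)"
    unfolding downstream_state_def by (metis swap_swap)
qed

lemma upstream_state_free:
  assumes "state_on a U" "q < Dem U"
  shows "upstream_state a U q = (capacity a, q)"
    "SOC a (upstream_state a U q)" "q < Dem (upstream_state a U q)"
  using assms by (auto simp: upstream_state_def SOC_def state_on_def)

lemma upstream_state_binding:
  assumes "state_on a U"
  shows "upstream_state a U (Dem U) = (Dem U, capacity a)"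
    "UC a (upstream_state a U (Dem U))"
  using assms by (auto simp: upstream_state_def UC_def state_on_def)

lemma downstream_state_free:
  assumes "state_on a U" "q < Sply U"
  shows "downstream_state a U q = (q, capacity a)"
    "SUC a (downstream_state a U q)" "q < Sply (downstream_state a U q)"
  using upstream_state_free[of a "prod.swap U" q] assms
  by (simp_all add: downstream_state_def SUC_def SOC_def)

lemma downstream_state_binding:
  assumes "state_on a U"
  shows "downstream_state a U (Sply U) = (capacity a, Sply U)"
    "OC a (downstream_state a U (Sply U))"
  using upstream_state_binding[of a "prod.swap U"] assms
  by (simp_all add: downstream_state_def UC_def OC_def)

lemma upstream_state_valid:
  assumes "state_on a U" "0 \<le> q" "q \<le> Dem U"
  shows "state_on a (upstream_state a U q)" "flow_rate (upstream_state a U q) = q"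
  using assms by (auto simp: upstream_state_def state_on_def flow_rate_def)

lemma downstream_state_valid:
  assumes "state_on a U" "0 \<le> q" "q \<le> Sply U"
  shows "state_on a (downstream_state a U q)" "flow_rate (downstream_state a U q) = q"
  using upstream_state_valid[of a "prod.swap U" q] assms by (simp_all add: downstream_state_def)

text \<open>Since one coordinate of a state is always the capacity, a state \<open>V\<close> with demand equal to
  \<open>D < C\<close> has supply \<open>C\<close>; if \<open>D = C\<close>, the lower bound on the supply has the same effect.\<close>

lemma interior_alternatives:
  assumes "state_on a V" "D \<le> capacity a" "D \<le> Dem V" "D \<le> Sply V"
  shows "V = (D, capacity a) \<or> Dem V > D \<and> Sply V \<ge> D"
  using assms by (cases V) (auto simp: state_on_def max_def split: if_splits)

section \<open>Solutions at the diverge\<close>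

lemma Min_triple_eq_iff:
  fixes a b c q :: "'a :: linorder"
  shows "q = Min {a, b, c} \<longleftrightarrow> q \<le> a \<and> q \<le> b \<and> q \<le> c \<and> (q = a \<or> q = b \<or> q = c)"
  by (auto simp: min_def)

text \<open>Through FIFO, all three stationary states are functions of the single number \<open>q\<^sub>0\<close>; this reduces
  their uniqueness to that of the flux.\<close>

lemma stationary_states:
  assumes initial: "\<forall>a\<in>{0,1,2}. state_on (L a) (U a)"
    and sol: "diverge_solution L \<xi> U z"
  shows "flux z 0 \<le> Dem (U 0)" "stationary z 0 = upstream_state (L 0) (U 0) (flux z 0)"
    and "i \<in> {1,2} \<Longrightarrow> flux z i = \<xi> i * flux z 0"
    and "i \<in> {1,2} \<Longrightarrow> flux z i \<le> Sply (U i)"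
    and "i \<in> {1,2} \<Longrightarrow> stationary z i = downstream_state (L i) (U i) (flux z i)"
proof -
  have cons: "traffic_conservation \<xi> z" and adm: "admissible_stationary L U z"
    using sol by (simp_all add: diverge_solution_def)
  have fl: "flux z a = flow_rate (stationary z a)" if "a \<in> {0,1,2}" for a
    using cons that unfolding traffic_conservation_def by blast
  have U0: "state_on (L 0) (U 0)"
    using initial by simp
  have V0: "stationary z 0 = (Dem (U 0), capacity (L 0)) \<or>
      (\<exists>S. stationary z 0 = (capacity (L 0), S) \<and> S < Dem (U 0))"
    using adm by (simp add: admissible_stationary_def)
  show "flux z 0 \<le> Dem (U 0)" "stationary z 0 = upstream_state (L 0) (U 0) (flux z 0)"
    by (fact admissible_upstream[OF U0 V0, folded fl[of 0, simplified]])+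
  assume i: "i \<in> {1,2}"
  then have a: "i \<in> {0,1,2}"
    by blast
  show "flux z i = \<xi> i * flux z 0"
    using cons i unfolding traffic_conservation_def by blast
  have Ui: "state_on (L i) (U i)"
    using initial a by blast
  have Vi: "stationary z i = (capacity (L i), Sply (U i)) \<or>
      (\<exists>D. stationary z i = (D, capacity (L i)) \<and> D < Sply (U i))"
    using adm i unfolding admissible_stationary_def by blast
  show "flux z i \<le> Sply (U i)" "stationary z i = downstream_state (L i) (U i) (flux z i)"
    by (fact admissible_downstream[OF Ui Vi, folded fl[OF a]])+
qed

lemma entropy_flux:
  assumes "diverge_solution L \<xi> U z" "t > 0"
  shows "flux z 0 = Min {Dem (interior z 0 t), Sply (interior z 1 t) / \<xi> 1, Sply (interior z 2 t) / \<xi> 2}"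
  using assms by (simp add: diverge_solution_def entropy_condition_def interior_proportions_def)

text \<open>If no bound were attained, then no link would leave its interior state any freedom, and the
  entropy condition would force the flux up to one of the bounds given by the capacities.\<close>

lemma flux_determined:
  assumes initial: "\<forall>a\<in>{0,1,2}. state_on (L a) (U a)"
    and pos: "\<xi> 1 > 0" "\<xi> 2 > 0"
    and sol: "diverge_solution L \<xi> U z"
  shows "flux z 0 = Min {Dem (U 0), Sply (U 1) / \<xi> 1, Sply (U 2) / \<xi> 2}"
proof -
  note st = stationary_states[OF initial sol]
  have adm: "admissible_interior L z"
    using sol by (simp add: diverge_solution_def)
  have le: "flux z 0 \<le> Sply (U i) / \<xi> i" if "i \<in> {1,2}" for i
    using st(3,4)[OF that] pos that by (auto simp: field_simps)
  have "flux z 0 = Dem (U 0) \<or> flux z 0 = Sply (U 1) / \<xi> 1 \<or> flux z 0 = Sply (U 2) / \<xi> 2"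
  proof (rule ccontr)
    assume contr: "\<not> ?thesis"
    have up: "flux z 0 < Dem (U 0)"
      using st(1) contr by simp
    have down: "flux z i < Sply (U i)" if i: "i \<in> {1,2}" for i
    proof -
      have "flux z 0 < Sply (U i) / \<xi> i"
        using le[OF i] contr i by auto
      then show ?thesis
        using st(3)[OF i] pos i by (auto simp: field_simps)
    qed
    (* Any positive time serves: the interior states are the stationary ones at all of them. *)
    have int0: "flux z 0 < Dem (interior z 0 1)"
      using upstream_state_free[of "L 0" "U 0" "flux z 0"] up initial adm st(2)
      by (simp add: admissible_interior_def)
    have inti: "flux z 0 < Sply (interior z i 1) / \<xi> i" if i: "i \<in> {1,2}" for i
    proof -
      have "state_on (L i) (U i)"
        using initial i by auto
      note free = downstream_state_free[OF this down[OF i]]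
      have "interior z i 1 = stationary z i"
        using free(2) st(5)[OF i] adm i by (auto simp: admissible_interior_def)
      then have "\<xi> i * flux z 0 < Sply (interior z i 1)"
        using free(3) st(3,5)[OF i] by simp
      then show ?thesis
        using pos i by (auto simp: field_simps)
    qed
    show False
      using entropy_flux[OF sol, of 1] int0 inti[of 1] inti[of 2] by (auto simp: min_def split: if_splits)
  qed
  then show ?thesis
    using st(1) le[of 1] le[of 2] by (simp only: Min_triple_eq_iff) simp
qed

lemma solution_upstream:
  assumes initial: "\<forall>a\<in>{0,1,2}. state_on (L a) (U a)"
    and sol: "diverge_solution L \<xi> U z"
  shows "Dem (U 0) > flux z 0 \<Longrightarrow>
      SOC (L 0) (stationary z 0) \<and> stationary z 0 = (capacity (L 0), flux z 0) \<and>
      (\<forall>t>0. interior z 0 t = stationary z 0)"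
    and "Dem (U 0) = flux z 0 \<Longrightarrow>
      UC (L 0) (stationary z 0) \<and> stationary z 0 = (Dem (U 0), capacity (L 0)) \<and>
      (\<forall>t>0. interior z 0 t = stationary z 0 \<or>
         Dem (interior z 0 t) > Dem (U 0) \<and> Sply (interior z 0 t) \<ge> Dem (U 0))"
proof -
  note st = stationary_states(1,2)[OF initial sol]
  have U: "state_on (L 0) (U 0)" and adm: "admissible_interior L z"
    using initial sol by (simp_all add: diverge_solution_def)
  show "SOC (L 0) (stationary z 0) \<and> stationary z 0 = (capacity (L 0), flux z 0) \<and>
      (\<forall>t>0. interior z 0 t = stationary z 0)" if "Dem (U 0) > flux z 0"
    using upstream_state_free[OF U that] st(2) adm by (simp add: admissible_interior_def)
  assume eq: "Dem (U 0) = flux z 0"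
  have uc: "UC (L 0) (stationary z 0)" and V: "stationary z 0 = (Dem (U 0), capacity (L 0))"
    using upstream_state_binding[OF U] st(2) eq by simp_all
  have "interior z 0 t = (Dem (U 0), capacity (L 0)) \<or>
      Dem (interior z 0 t) > Dem (U 0) \<and> Sply (interior z 0 t) \<ge> Dem (U 0)" if t: "t > 0" for t
  proof (rule interior_alternatives)
    show "state_on (L 0) (interior z 0 t)"
      using sol t by (simp add: diverge_solution_def states_valid_def)
    show "Dem (U 0) \<le> capacity (L 0)"
      using U by (simp add: state_on_def)
    show "Dem (U 0) \<le> Dem (interior z 0 t)"
      using entropy_flux[OF sol t] eq by simp
    show "Dem (U 0) \<le> Sply (interior z 0 t)"
      using adm t uc V by (simp add: admissible_interior_def)
  qed
  then show "UC (L 0) (stationary z 0) \<and> stationary z 0 = (Dem (U 0), capacity (L 0)) \<and>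
      (\<forall>t>0. interior z 0 t = stationary z 0 \<or>
         Dem (interior z 0 t) > Dem (U 0) \<and> Sply (interior z 0 t) \<ge> Dem (U 0))"
    using uc V by simp
qed

lemma solution_downstream:
  assumes initial: "\<forall>a\<in>{0,1,2}. state_on (L a) (U a)"
    and pos: "\<xi> 1 > 0" "\<xi> 2 > 0"
    and sol: "diverge_solution L \<xi> U z"
    and i: "i \<in> {1,2}"
  shows "Sply (U i) / \<xi> i > flux z 0 \<Longrightarrow>
      SUC (L i) (stationary z i) \<and> stationary z i = (flux z i, capacity (L i)) \<and>
      (\<forall>t>0. interior z i t = stationary z i)"
    and "Sply (U i) / \<xi> i = flux z 0 \<Longrightarrow>
      OC (L i) (stationary z i) \<and> stationary z i = (capacity (L i), Sply (U i)) \<and>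
      (\<forall>t>0. interior z i t = stationary z i \<or>
         Dem (interior z i t) \<ge> Sply (U i) \<and> Sply (interior z i t) > Sply (U i))"
proof -
  note st = stationary_states(3-5)[OF initial sol i]
  have U: "state_on (L i) (U i)" and \<xi>i: "\<xi> i > 0"
    using initial pos i by auto
  have adm: "SUC (L i) (stationary z i) \<Longrightarrow> interior z i t = stationary z i"
    "OC (L i) (stationary z i) \<Longrightarrow> Dem (interior z i t) \<ge> Sply (stationary z i)"
    if "t > 0" for t
    using sol i that by (auto simp: diverge_solution_def admissible_interior_def)
  show "SUC (L i) (stationary z i) \<and> stationary z i = (flux z i, capacity (L i)) \<and>
      (\<forall>t>0. interior z i t = stationary z i)" if "Sply (U i) / \<xi> i > flux z 0"
  proof -
    have "flux z i < Sply (U i)"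
      using that st(1) \<xi>i by (simp add: field_simps)
    from downstream_state_free[OF U this] show ?thesis
      using st(3) adm(1) by simp
  qed
  assume "Sply (U i) / \<xi> i = flux z 0"
  then have eq: "Sply (U i) = flux z i"
    using st(1) \<xi>i by (simp add: field_simps)
  have oc: "OC (L i) (stationary z i)" and V: "stationary z i = (capacity (L i), Sply (U i))"
    using downstream_state_binding[OF U] st(3) eq by simp_all
  have "interior z i t = (capacity (L i), Sply (U i)) \<or>
      Dem (interior z i t) \<ge> Sply (U i) \<and> Sply (interior z i t) > Sply (U i)" if t: "t > 0" for t
  proof -
    have "flux z 0 \<le> Sply (interior z i t) / \<xi> i"
      using entropy_flux[OF sol t] i by auto
    then have "Sply (U i) \<le> Sply (interior z i t)"
      using eq st(1) \<xi>i by (simp add: field_simps)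
    moreover have "state_on (L i) (interior z i t)"
      using sol t i by (auto simp: diverge_solution_def states_valid_def)
    moreover have "Sply (U i) \<le> capacity (L i)"
      using U by (simp add: state_on_def)
    moreover have "Sply (U i) \<le> Dem (interior z i t)"
      using adm(2)[OF t oc] V by simp
    ultimately have "prod.swap (interior z i t) = (Sply (U i), capacity (L i)) \<or>
        Dem (prod.swap (interior z i t)) > Sply (U i) \<and>
        Sply (prod.swap (interior z i t)) \<ge> Sply (U i)"
      by (intro interior_alternatives) simp_all
    then show ?thesis
      by (cases "interior z i t") auto
  qed
  then show "OC (L i) (stationary z i) \<and> stationary z i = (capacity (L i), Sply (U i)) \<and>
      (\<forall>t>0. interior z i t = stationary z i \<or>
         Dem (interior z i t) \<ge> Sply (U i) \<and> Sply (interior z i t) > Sply (U i))"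
    using oc V by simp
qed

text \<open>The witness satisfies the entropy condition because a link that attains the minimum keeps its
  demand or supply, while any other link has its term raised to capacity, hence still above \<open>q\<close>.\<close>

lemma solution_exists:
  assumes initial: "\<forall>a\<in>{0,1,2}. state_on (L a) (U a)"
    and pos: "\<xi> 1 > 0" "\<xi> 2 > 0" and sum: "\<xi> 1 + \<xi> 2 = 1"
  shows "\<exists>z. diverge_solution L \<xi> U z \<and>
    (\<forall>a\<in>{0,1,2}. \<forall>t>0. interior z a t = stationary z a)"
proof -
  define q where "q = Min {Dem (U 0), Sply (U 1) / \<xi> 1, Sply (U 2) / \<xi> 2}"
  define f where "f = (\<lambda>a::nat. if a = 0 then q else \<xi> a * q)"
  define V where "V = (\<lambda>a. if a = 0 then upstream_state (L 0) (U 0) q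
                            else downstream_state (L a) (U a) (\<xi> a * q))"
  define z where "z = \<lparr>flux = f, stationary = V, interior = (\<lambda>a t. V a), int_prop = (\<lambda>i t. \<xi> i)\<rparr>"
  have U: "state_on (L 0) (U 0)" "\<And>i. i \<in> {1,2} \<Longrightarrow> state_on (L i) (U i)"
    using initial by auto
  have \<xi>i: "\<xi> i > 0" if "i \<in> {1,2}" for i
    using pos that by auto
  have q: "q \<le> Dem (U 0)" "q \<le> Sply (U 1) / \<xi> 1" "q \<le> Sply (U 2) / \<xi> 2"
    "q = Dem (U 0) \<or> q = Sply (U 1) / \<xi> 1 \<or> q = Sply (U 2) / \<xi> 2"
    using q_def[unfolded Min_triple_eq_iff] by auto
  have q0: "0 \<le> q"
    using q(4) U(1) U(2)[of 1] U(2)[of 2] pos by (auto simp: state_on_def)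
  have qi: "\<xi> i * q \<le> Sply (U i)" if "i \<in> {1,2}" for i
    using q(2,3) pos that by (auto simp: field_simps)
  have qi0: "0 \<le> \<xi> i * q" if "i \<in> {1,2}" for i
    using q0 \<xi>i[OF that] by simp
  have up: "state_on (L 0) (V 0)" "flow_rate (V 0) = q"
    using upstream_state_valid[OF U(1) q0 q(1)] by (simp_all add: V_def)
  have down: "state_on (L i) (V i)" "flow_rate (V i) = \<xi> i * q" if "i \<in> {1,2}" for i
    using downstream_state_valid[OF U(2) qi0 qi] that by (auto simp: V_def)
  have V0: "V 0 = (Dem (U 0), capacity (L 0)) \<and> q = Dem (U 0) \<or>
      V 0 = (capacity (L 0), q) \<and> q < Dem (U 0) \<and> q < Dem (V 0)"
    using upstream_state_free[OF U(1), of q] upstream_state_binding[OF U(1)] q(1)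
    by (cases "q = Dem (U 0)") (auto simp: V_def)
  have Vi: "V i = (capacity (L i), Sply (U i)) \<and> \<xi> i * q = Sply (U i) \<or>
      V i = (\<xi> i * q, capacity (L i)) \<and> \<xi> i * q < Sply (U i) \<and> \<xi> i * q < Sply (V i)"
    if i: "i \<in> {1,2}" for i
    using downstream_state_free[OF U(2)[OF i], of "\<xi> i * q"] downstream_state_binding[OF U(2)[OF i]]
      qi[OF i] i
    by (cases "\<xi> i * q = Sply (U i)") (auto simp: V_def)
  have "states_valid L z"
    using up down by (simp add: states_valid_def z_def)
  moreover have "traffic_conservation \<xi> z"
    using up down sum by (simp add: traffic_conservation_def z_def f_def flip: distrib_right)
  moreover have "interior_proportions \<xi> z"
    by (simp add: interior_proportions_def z_def)
  moreover have "entropy_condition z"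
  proof -
    have term0: "q \<le> Dem (V 0)" "q = Dem (U 0) \<Longrightarrow> q = Dem (V 0)"
      using V0 by auto
    have termi: "q \<le> Sply (V i) / \<xi> i" "q = Sply (U i) / \<xi> i \<Longrightarrow> q = Sply (V i) / \<xi> i"
      if i: "i \<in> {1,2}" for i
      using Vi[OF i] \<xi>i[OF i] by (auto simp: field_simps)
    have "q = Min {Dem (V 0), Sply (V 1) / \<xi> 1, Sply (V 2) / \<xi> 2}"
      unfolding Min_triple_eq_iff using term0 termi[of 1] termi[of 2] q(4) by blast
    then show ?thesis
      by (simp add: entropy_condition_def z_def f_def)
  qed
  moreover have "admissible_stationary L U z"
    using V0 Vi unfolding admissible_stationary_def z_def by fastforce
  moreover have "admissible_interior L z"
  proof -
    have "UC (L 0) (V 0) \<Longrightarrow> Dem (V 0) \<le> Sply (V 0)"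
      using up(1) by (simp add: UC_def state_on_def)
    moreover have "OC (L i) (V i) \<Longrightarrow> Sply (V i) \<le> Dem (V i)" if "i \<in> {1,2}" for i
      using down(1)[OF that] by (simp add: OC_def state_on_def)
    ultimately show ?thesis
      by (simp add: admissible_interior_def z_def)
  qed
  ultimately have "diverge_solution L \<xi> U z"
    by (simp add: diverge_solution_def)
  moreover have "\<forall>a\<in>{0,1,2}. \<forall>t>0. interior z a t = stationary z a"
    by (simp add: z_def)
  ultimately show ?thesis
    by blast
qed

section \<open>Boundary fluxes, stationary and interior states\<close>

theorem theorem4p1:
  fixes L :: "nat \<Rightarrow> link" and \<xi> :: "nat \<Rightarrow> real" and U :: "nat \<Rightarrow> state"
  assumes links: "\<forall>a\<in>{0,1,2}. unimodal_link (L a)"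
    and initial: "\<forall>a\<in>{0,1,2}. state_on (L a) (U a)"
    and prop_pos: "\<xi> 1 > 0" "\<xi> 2 > 0"
    and prop_sum: "\<xi> 1 + \<xi> 2 = 1"
  shows "(\<exists>z. diverge_solution L \<xi> U z \<and>
              (\<forall>a\<in>{0,1,2}. \<forall>t>0. interior z a t = stationary z a)) \<and>
    (\<forall>z. diverge_solution L \<xi> U z \<longrightarrow>
       flux z 0 = Min {Dem (U 0), Sply (U 1) / \<xi> 1, Sply (U 2) / \<xi> 2} \<and>
       (\<forall>i\<in>{1,2}. flux z i = \<xi> i * flux z 0) \<and>
       (Dem (U 0) > flux z 0 \<longrightarrow>
          SOC (L 0) (stationary z 0) \<and>
          stationary z 0 = (capacity (L 0), flux z 0) \<and>
          (\<forall>t>0. interior z 0 t = stationary z 0)) \<and>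
       (Dem (U 0) = flux z 0 \<longrightarrow>
          UC (L 0) (stationary z 0) \<and>
          stationary z 0 = (Dem (U 0), capacity (L 0)) \<and>
          (\<forall>t>0. interior z 0 t = stationary z 0 \<or>
             Dem (interior z 0 t) > Dem (U 0) \<and> Sply (interior z 0 t) \<ge> Dem (U 0))) \<and>
       (\<forall>i\<in>{1,2}.
          (Sply (U i) / \<xi> i > flux z 0 \<longrightarrow>
             SUC (L i) (stationary z i) \<and>
             stationary z i = (flux z i, capacity (L i)) \<and>
             (\<forall>t>0. interior z i t = stationary z i)) \<and>
          (Sply (U i) / \<xi> i = flux z 0 \<longrightarrow>
             OC (L i) (stationary z i) \<and>
             stationary z i = (capacity (L i), Sply (U i)) \<and>
             (\<forall>t>0. interior z i t = stationary z i \<or>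
                Dem (interior z i t) \<ge> Sply (U i) \<and> Sply (interior z i t) > Sply (U i)))))"
proof (intro conjI allI impI)
  show "\<exists>z. diverge_solution L \<xi> U z \<and>
      (\<forall>a\<in>{0,1,2}. \<forall>t>0. interior z a t = stationary z a)"
    using solution_exists[of L U \<xi>] initial prop_pos prop_sum by blast
next
  fix z
  assume sol: "diverge_solution L \<xi> U z"
  show "flux z 0 = Min {Dem (U 0), Sply (U 1) / \<xi> 1, Sply (U 2) / \<xi> 2}"
    by (rule flux_determined[OF initial prop_pos sol])
  show "\<forall>i\<in>{1,2}. flux z i = \<xi> i * flux z 0"
    using stationary_states(3)[OF initial sol] by blast
qed (use solution_upstream[OF initial] solution_downstream[OF initial prop_pos] in blast)+

end
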